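(* Let $a,b\geq 0$ be real numbers, and define $$f(z)=\frac{\Gamma(z+1)\,\Gamma(z-a-b+1)}{\Gamma(z-a+1)\,\Gamma(z-b+1)},\qquad z>a+b-1.$$ Then $f$ is a completely monotonic function on the interval $(a+b-1,\infty)$.
   Context: $\Gamma(x)=\int_0^\infty e^{-t}t^{x-1}\,dt$ for $x>0$ is the gamma function. A real function $f$ is called completely monotonic on an interval $I\subset\mathbb{R}$ if it has derivatives $f^{(n)}$ of every order $n=0,1,2,\dots$ on $I$ and $(-1)^n f^{(n)}(z)\geq 0$ for all $z\in I$ and all $n\geq 0$. *)

theory Defs
  imports "HOL-Analysis.Analysis"
begin

(* D n is the n-th derivative of f on I. Derivatives are taken within I, so they are one-sided at
   endpoints belonging to I and ordinary derivatives when I is open; the sequence D is then uniquely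
   determined on I, unless I is a single point. Values of f outside I are irrelevant. *)
definition completely_monotonic_on :: "real set \<Rightarrow> (real \<Rightarrow> real) \<Rightarrow> bool" where
  "completely_monotonic_on I f \<longleftrightarrow>
     (\<exists>D :: nat \<Rightarrow> real \<Rightarrow> real.
        (\<forall>z\<in>I. D 0 z = f z) \<and>
        (\<forall>n. \<forall>z\<in>I. (D n has_real_derivative D (Suc n) z) (at z within I)) \<and>
        (\<forall>n. \<forall>z\<in>I. (-1) ^ n * D n z \<ge> 0))"

end

theory Submission
  imports Defs
begin

text \<open>
  The logarithmic derivative of \<open>f\<close> and its derivatives are
  \<open>G n z = P n (z + 1) + P n (z - a - b + 1) - P n (z - a + 1) - P n (z - b + 1)\<close>,
  where \<open>P n\<close> is the \<open>n\<close>-th polygamma function. Since \<open>(-1) ^ (n + 1) * P n\<close> is convex on the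
  positive reals and \<open>z - a + 1\<close>, \<open>z - b + 1\<close> lie symmetrically between \<open>z - a - b + 1\<close> and
  \<open>z + 1\<close>, we get \<open>(-1) ^ n * G n \<le> 0\<close>. Expanding the derivatives of \<open>f' = f * G 0\<close> by the
  Leibniz rule, all terms of the \<open>n\<close>-th derivative of \<open>f\<close> then have the sign \<open>(-1) ^ n\<close>.
\<close>

text \<open>Inductive step of the Leibniz rule, with \<open>u k\<close> and \<open>v k\<close> in
  the role of \<open>k\<close>-th derivatives; it rests on Pascal's rule.\<close>

lemma sum_choose_Suc_Leibniz:
  fixes u v :: "nat \<Rightarrow> 'a::comm_semiring_1"
  shows "(\<Sum>k\<le>n. of_nat (n choose k) * (u (Suc k) * v (n - k) + u k * v (Suc (n - k)))) =
         (\<Sum>k\<le>Suc n. of_nat (Suc n choose k) * (u k * v (Suc n - k)))"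
proof -
  \<comment> \<open>The added term \<open>k = Suc n\<close> vanishes because
    \<open>n choose Suc n = 0\<close>.\<close>
  have "(\<Sum>k\<le>n. of_nat (n choose k) * (u k * v (Suc (n - k)))) =
        (\<Sum>k\<le>Suc n. of_nat (n choose k) * (u k * v (Suc n - k)))"
    by (simp add: Suc_diff_le binomial_eq_0)
  also have "\<dots> = u 0 * v (Suc n) +
        (\<Sum>k\<le>n. of_nat (n choose Suc k) * (u (Suc k) * v (n - k)))"
    by (subst sum.atMost_Suc_shift) simp
  finally show ?thesis
    by (subst sum.atMost_Suc_shift) (simp add: sum.distrib algebra_simps)
qed

text \<open>If \<open>f' = f * G 0\<close> and \<open>G (n + 1)\<close> is the derivative of \<open>G n\<close>, this is the \<open>n\<close>-th
  derivative of \<open>f\<close>.\<close>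

fun log_deriv_iter :: "(real \<Rightarrow> real) \<Rightarrow> (nat \<Rightarrow> real \<Rightarrow> real) \<Rightarrow> nat \<Rightarrow> real \<Rightarrow> real" where
  "log_deriv_iter f G 0 z = f z"
| "log_deriv_iter f G (Suc n) z =
     (\<Sum>k\<le>n. real (n choose k) * (log_deriv_iter f G k z * G (n - k) z))"

lemma has_real_derivative_log_deriv_iter:
  assumes "\<And>z. z \<in> I \<Longrightarrow> (f has_real_derivative f z * G 0 z) (at z within I)"
    and "\<And>n z. z \<in> I \<Longrightarrow> (G n has_real_derivative G (Suc n) z) (at z within I)"
    and "z \<in> I"
  shows "(log_deriv_iter f G n has_real_derivative log_deriv_iter f G (Suc n) z) (at z within I)"
\<comment> \<open>Strong induction, since the recursion at \<open>Suc m\<close> involves all orders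
  \<open>k \<le> m\<close>.\<close>
proof (induction n rule: less_induct)
  case (less n)
  show ?case
  proof (cases n)
    case 0
    then have "log_deriv_iter f G n = f"
      by (simp add: fun_eq_iff)
    with 0 assms(1,3) show ?thesis
      by simp
  next
    case (Suc m)
    let ?D = "log_deriv_iter f G"
    have D_n: "?D n = (\<lambda>z. \<Sum>k\<le>m. real (m choose k) * (?D k z * G (m - k) z))"
      by (simp add: Suc fun_eq_iff)
    have "(?D n has_real_derivative
        (\<Sum>k\<le>m. real (m choose k) * (?D (Suc k) z * G (m - k) z + ?D k z * G (Suc (m - k)) z)))
        (at z within I)"
      unfolding D_n
    proof (rule DERIV_sum, rule DERIV_cmult)
      fix k
      assume "k \<in> {..m}"
      with Suc have "(?D k has_real_derivative ?D (Suc k) z) (at z within I)"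
        by (intro less.IH) simp
      from DERIV_mult[OF this assms(2)[OF \<open>z \<in> I\<close>, of "m - k"]]
      show "((\<lambda>z. ?D k z * G (m - k) z) has_real_derivative
          ?D (Suc k) z * G (m - k) z + ?D k z * G (Suc (m - k)) z) (at z within I)"
        by (simp add: mult.commute del: log_deriv_iter.simps)
    qed
    also have "(\<Sum>k\<le>m. real (m choose k) * (?D (Suc k) z * G (m - k) z + ?D k z * G (Suc (m - k)) z))
        = ?D (Suc n) z"
      unfolding Suc log_deriv_iter.simps(2)[of f G "Suc m"]
      by (rule sum_choose_Suc_Leibniz[where u = "\<lambda>k. ?D k z" and v = "\<lambda>k. G k z"])
    finally show ?thesis .
  qed
qed

text \<open>As \<open>(-1) ^ Suc m = - ((-1) ^ k * (-1) ^ (m - k))\<close>, each summand of the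
  recursion splits into two nonnegative factors; the extra minus sign goes to
  \<open>G\<close>.\<close>

lemma log_deriv_iter_sign:
  assumes "0 \<le> f z" and "\<And>n. (-1) ^ n * G n z \<le> 0"
  shows "0 \<le> (-1) ^ n * log_deriv_iter f G n z"
proof (induction n rule: less_induct)
  case (less n)
  show ?case
  proof (cases n)
    case 0
    then show ?thesis
      using assms(1) by simp
  next
    case (Suc m)
    have "0 \<le> (\<Sum>k\<le>m. real (m choose k) *
        (((-1) ^ k * log_deriv_iter f G k z) * - ((-1) ^ (m - k) * G (m - k) z)))"
    proof (rule sum_nonneg, rule mult_nonneg_nonneg[OF of_nat_0_le_iff], rule mult_nonneg_nonneg)
      fix k
      assume "k \<in> {..m}"
      with Suc show "0 \<le> (-1) ^ k * log_deriv_iter f G k z"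
        by (intro less.IH) simp
      show "0 \<le> - ((-1) ^ (m - k) * G (m - k) z)"
        using assms(2) by simp
    qed
    also have "\<dots> = (\<Sum>k\<le>m. (-1) ^ n * (real (m choose k) * (log_deriv_iter f G k z * G (m - k) z)))"
    proof (rule sum.cong[OF refl])
      fix k
      assume "k \<in> {..m}"
      then have "(-1) ^ n = - ((-1) ^ k * (-1) ^ (m - k) :: real)"
        unfolding Suc by (simp flip: power_add)
      then show "real (m choose k) *
          (((-1) ^ k * log_deriv_iter f G k z) * - ((-1) ^ (m - k) * G (m - k) z)) =
          (-1) ^ n * (real (m choose k) * (log_deriv_iter f G k z * G (m - k) z))"
        by (simp add: algebra_simps)
    qed
    also have "\<dots> = (-1) ^ n * log_deriv_iter f G n z"
      by (simp add: Suc sum_distrib_left)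
    finally show ?thesis .
  qed
qed

lemma completely_monotonic_on_log_deriv:
  assumes "\<And>z. z \<in> I \<Longrightarrow> 0 \<le> f z"
    and "\<And>z. z \<in> I \<Longrightarrow> (f has_real_derivative f z * G 0 z) (at z within I)"
    and "\<And>n z. z \<in> I \<Longrightarrow> (G n has_real_derivative G (Suc n) z) (at z within I)"
    and "\<And>n z. z \<in> I \<Longrightarrow> (-1) ^ n * G n z \<le> 0"
  shows "completely_monotonic_on I f"
  unfolding completely_monotonic_on_def
  using has_real_derivative_log_deriv_iter[of I f G] log_deriv_iter_sign[of f _ G] assms
  by (intro exI[of _ "log_deriv_iter f G"]) (simp del: log_deriv_iter.simps(2))

text \<open>Each inner value lies below the chord over \<open>[x, x + a + b]\<close>. The weights
  \<open>a / (a + b)\<close> and \<open>b / (a + b)\<close> add up to 1, so the two chord bounds sum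
  to the endpoint values.\<close>

lemma convex_on_parallelogram:
  fixes h :: "real \<Rightarrow> real"
  assumes h: "convex_on S h" and S: "x \<in> S" "x + a + b \<in> S" and "0 \<le> a" "0 \<le> b"
  shows "h (x + a) + h (x + b) \<le> h x + h (x + a + b)"
proof (cases "a + b = 0")
  case True
  then show ?thesis
    using \<open>0 \<le> a\<close> \<open>0 \<le> b\<close> by (simp add: add_nonneg_eq_0_iff)
next
  case False
  have *: "h (x + c) \<le> (1 - c / (a + b)) * h x + c / (a + b) * h (x + a + b)"
    if "0 \<le> c" "c \<le> a + b" for c
  proof -
    have "x + c = x + c / (a + b) * (a + b)"
      using False by simp
    also have "\<dots> = (1 - c / (a + b)) *\<^sub>R x + (c / (a + b)) *\<^sub>R (x + a + b)"
      unfolding real_scaleR_def by algebra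
    finally have "x + c = (1 - c / (a + b)) *\<^sub>R x + (c / (a + b)) *\<^sub>R (x + a + b)" .
    then show ?thesis
      using convex_onD[OF h _ _ S, of "c / (a + b)"] that False by simp
  qed
  have "h (x + a) + h (x + b) \<le>
      ((1 - a / (a + b)) + (1 - b / (a + b))) * h x + (a / (a + b) + b / (a + b)) * h (x + a + b)"
    using *[of a] *[of b] \<open>0 \<le> a\<close> \<open>0 \<le> b\<close> by (simp add: algebra_simps)
  also have "a / (a + b) + b / (a + b) = 1"
    using False by (simp flip: add_divide_distrib)
  then have "((1 - a / (a + b)) + (1 - b / (a + b))) * h x +
      (a / (a + b) + b / (a + b)) * h (x + a + b) = h x + h (x + a + b)"
    by (simp add: algebra_simps)
  finally show ?thesis .
qed

text \<open>Differentiating twice raises the order by 2 and keeps its parity, and polygamma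
  functions of positive order alternate in sign. This covers \<open>n = 0\<close> too, although the
  digamma function itself changes sign.\<close>

lemma convex_on_Polygamma_real:
  "convex_on {0<..} (\<lambda>x::real. (-1) ^ Suc n * Polygamma n x)"
proof (rule f''_ge0_imp_convex)
  fix x :: real
  assume x: "x \<in> {0<..}"
  then have x': "x \<notin> \<int>\<^sub>\<le>\<^sub>0"
    by (auto elim: nonpos_Ints_cases)
  show "((\<lambda>x. (-1) ^ Suc n * Polygamma n x) has_real_derivative
          (-1) ^ Suc n * Polygamma (Suc n) x) (at x)"
    "((\<lambda>x. (-1) ^ Suc n * Polygamma (Suc n) x) has_real_derivative
          (-1) ^ Suc n * Polygamma (Suc (Suc n)) x) (at x)"
    using x' by (intro DERIV_cmult has_field_derivative_Polygamma; assumption)+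
  show "0 \<le> (-1) ^ Suc n * Polygamma (Suc (Suc n)) x"
    using x x' Polygamma_real_odd_pos[of x "Suc (Suc n)"]
      Polygamma_real_even_neg[of x "Suc (Suc n)"]
    by (cases "even n") auto
qed simp

theorem theorem2p2:
  fixes a b :: real
  assumes "a \<ge> 0" and "b \<ge> 0"
  shows "completely_monotonic_on {a + b - 1<..}
           (\<lambda>z. Gamma (z + 1) * Gamma (z - a - b + 1) / (Gamma (z - a + 1) * Gamma (z - b + 1)))"
proof -
  define G :: "nat \<Rightarrow> real \<Rightarrow> real" where
    "G n z = Polygamma n (z + 1) + Polygamma n (z - a - b + 1)
      - Polygamma n (z - a + 1) - Polygamma n (z - b + 1)" for n z
  have pos: "0 < z + 1" "0 < z - a - b + 1" "0 < z - a + 1" "0 < z - b + 1"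
    if "z \<in> {a + b - 1<..}" for z
    using that assms by auto
  have notin: "x \<notin> \<int>\<^sub>\<le>\<^sub>0" if "0 < x" for x :: real
    using that by (auto elim: nonpos_Ints_cases)
  show ?thesis
  proof (rule completely_monotonic_on_log_deriv[where G = G])
    fix z
    assume z: "z \<in> {a + b - 1<..}"
    note pos = pos[OF z]
    note notin = pos[THEN notin]
    note Gamma_pos = pos[THEN Gamma_real_pos]
    let ?f = "\<lambda>z. Gamma (z + 1) * Gamma (z - a - b + 1) / (Gamma (z - a + 1) * Gamma (z - b + 1))"
    show "0 \<le> ?f z"
      using Gamma_pos by simp
    show "(?f has_real_derivative ?f z * G 0 z) (at z within {a + b - 1<..})"
      \<comment> \<open>Each factor contributes \<open>Gamma' = Gamma * Polygamma 0\<close>;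
        positivity of the Gamma values allows clearing denominators.\<close>
      using notin Gamma_pos[THEN less_imp_neq]
      by (auto intro!: derivative_eq_intros simp: G_def field_simps)
    show "(G n has_real_derivative G (Suc n) z) (at z within {a + b - 1<..})" for n
      unfolding G_def using notin by (auto intro!: derivative_eq_intros)
    \<comment> \<open>With \<open>x = z - a - b + 1\<close>, the points \<open>x + a\<close>,
      \<open>x + b\<close>, \<open>x + a + b\<close> are \<open>z - b + 1\<close>,
      \<open>z - a + 1\<close>, \<open>z + 1\<close>.\<close>
    have "(-1) ^ Suc n * Polygamma n (z - b + 1) + (-1) ^ Suc n * Polygamma n (z - a + 1)
        \<le> (-1) ^ Suc n * Polygamma n (z - a - b + 1) + (-1) ^ Suc n * Polygamma n (z + 1)" for n
      using convex_on_parallelogram[OF convex_on_Polygamma_real, of "z - a - b + 1" a b n] assms pos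
      by (simp add: algebra_simps)
    then show "(-1) ^ n * G n z \<le> 0" for n
      by (simp add: G_def algebra_simps)
  qed
qed

end
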